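(* Let $\Gamma$ be a connected graph whose vertex degrees do not exceed some natural number $d$. Then: 1) The set $\mathbb{C}\setminus(\mathbb{R}_{\geq -d}\cap\mathbb{R}_{\leq d})$ is contained in the resolvent set of the operator $A^{(l_2)}_{\Gamma,\mathbb{C}}$. Thus for each $\lambda\in\mathbb{C}\setminus(\mathbb{R}_{\geq -d}\cap\mathbb{R}_{\leq d})$ there is a well-defined bounded linear operator $R_{\Gamma,d,\lambda}:=(A^{(l_2)}_{\Gamma,\mathbb{C}}-\lambda E)^{-1}$ on $l_2(V(\Gamma))$. 2) For all $v\in V(\Gamma)$ and $\lambda\in\mathbb{C}\setminus(\mathbb{R}_{\geq -d}\cap\mathbb{R}_{\leq d})$ the function $R_{\Gamma,d,\lambda}(\delta_v)\in\mathbb{C}^{V(\Gamma)}$ is a $(\mathbb{C},\lambda)$-propagator of $\Gamma$ with respect to $v$; it lies in $l_2(V(\Gamma))$ and is the unique $(\mathbb{C},\lambda)$-propagator of $\Gamma$ with respect to $v$ with this property. 3) For $v,w\in V(\Gamma)$ and $\lambda\in\mathbb{C}\setminus(\mathbb{R}_{\geq -d}\cap\mathbb{R}_{\leq d})$ put $$\tilde s_{\Gamma,d,\lambda,v}(w):=(R_{\Gamma,d,\lambda}(\delta_v))(w)=(R_{\Gamma,d,\lambda}(\delta_v),\delta_w)$$ (the inner product in $l_2(V(\Gamma))$). Then for any fixed $v,w\in V(\Gamma)$ the function $\lambda\mapsto\tilde s_{\Gamma,d,\lambda,v}(w)$ on $\mathbb{C}\setminus(\mathbb{R}_{\geq -d}\cap\mathbb{R}_{\leq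 d})$ is analytic, and on the set $\{\lambda\in\mathbb{C}:|\lambda|>d\}$ it coincides with the function $\lambda\mapsto s_{\Gamma,\lambda,v}(w)$.
   Context: A graph is an undirected graph without loops or multiple edges, with vertex set $V(\Gamma)$; $\Gamma(v)$ is the set of vertices adjacent to $v$. $\mathbb{C}$ carries the usual absolute value. $\mathbb{C}^{V(\Gamma)}$ is the space of all functions $V(\Gamma)\to\mathbb{C}$; $A_{\Gamma,\mathbb{C}}:\mathbb{C}^{V(\Gamma)}\to\mathbb{C}^{V(\Gamma)}$ is $(A_{\Gamma,\mathbb{C}}(f))(v)=\sum_{u\in\Gamma(v)}f(u)$; $E$ is the identity. $l_2(V(\Gamma))\subseteq\mathbb{C}^{V(\Gamma)}$ is the Hilbert space of square-summable functions with inner product $(f_1,f_2)=\sum_{u\in V(\Gamma)}f_1(u)\overline{f_2(u)}$. When vertex degrees are bounded, $l_2(V(\Gamma))$ is invariant under $A_{\Gamma,\mathbb{C}}$, and $A^{(l_2)}_{\Gamma,\mathbb{C}}$ denotes the restriction of $A_{\Gamma,\mathbb{C}}$ to $l_2(V(\Gamma))$, a bounded everywhere defined operator. The resolvent set of a bounded operator $A$ on $l_2(V(\Gamma))$ is the set of $\lambda\in\mathbb{C}$ such that $A-\lambda E$ is a bijection of $l_2(V(\Gamma))$ onto itself. $\delta_v$ is the function equal to $1$ at $v$ and $0$ elsewhere. A $(\mathbb{C},\lambda)$-propagator of $\Gamma$ with respect to $v$ is any $f\in\mathbb{C}^{V(\Gamma)}$ with $(A_{\Gamma,\mathbb{C}}-\lambda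 E)(f)=\delta_v$. The set $\mathbb{R}_{\geq -d}\cap\mathbb{R}_{\leq d}$ is the real interval $[-d,d]$. For $n\ge 0$, $N_\Gamma(v,w,n)$ is the number of paths (walks, vertices may repeat) of length $n$ in $\Gamma$ starting at $v$ and ending at $w$, and $s_{\Gamma,\lambda,v}(w):=-\lambda^{-1}\sum_{n\geq 0}N_\Gamma(v,w,n)\lambda^{-n}$ whenever this series converges (which it does for $|\lambda|>d$, since $N_\Gamma(v,w,n)\le d^n$). *)

theory Defs
  imports "Graph_Theory.Graph_Theory" "HOL-Analysis.Analysis"
begin

text \<open>
  Undirected graphs without loops or multiple edges, possibly infinite, are the symmetric
  loop-free pair digraphs of the locale predicate \<open>pair_bidirected_digraph\<close>: an edge is
  the pair of opposite arcs \<open>(u, v)\<close>, \<open>(v, u)\<close>.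
\<close>

definition nbrs :: "'a pair_pre_digraph \<Rightarrow> 'a \<Rightarrow> 'a set" where
  "nbrs G v = {u. (v, u) \<in> parcs G}"

text \<open>Finiteness is required separately because \<open>card\<close> of an infinite set is 0.\<close>

definition degrees_le :: "'a pair_pre_digraph \<Rightarrow> nat \<Rightarrow> bool" where
  "degrees_le G d \<longleftrightarrow> (\<forall>v\<in>pverts G. finite (nbrs G v) \<and> card (nbrs G v) \<le> d)"

text \<open>
  A function on \<open>V\<close> is represented by its extension by 0 to the whole type, so that
  equality of representatives is equality on \<open>V\<close>.
\<close>

definition fun_space :: "'a set \<Rightarrow> ('a \<Rightarrow> complex) set" where
  "fun_space V = {f. \<forall>v. v \<notin> V \<longrightarrow> f v = 0}"

definition l2 :: "'a set \<Rightarrow> ('a \<Rightarrow> complex) set" where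
  "l2 V = {f \<in> fun_space V. (\<lambda>v. (cmod (f v))\<^sup>2) summable_on V}"

definition l2_inner :: "'a set \<Rightarrow> ('a \<Rightarrow> complex) \<Rightarrow> ('a \<Rightarrow> complex) \<Rightarrow> complex" where
  "l2_inner V f g = (\<Sum>\<^sub>\<infinity>u\<in>V. f u * cnj (g u))"

definition l2_norm :: "'a set \<Rightarrow> ('a \<Rightarrow> complex) \<Rightarrow> real" where
  "l2_norm V f = sqrt (Re (l2_inner V f f))"

definition bounded_linear_on_l2 ::
    "'a set \<Rightarrow> (('a \<Rightarrow> complex) \<Rightarrow> ('a \<Rightarrow> complex)) \<Rightarrow> bool" where
  "bounded_linear_on_l2 V T \<longleftrightarrow>
     (\<forall>f\<in>l2 V. T f \<in> l2 V) \<and>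
     (\<forall>f\<in>l2 V. \<forall>g\<in>l2 V. T (\<lambda>u. f u + g u) = (\<lambda>u. T f u + T g u)) \<and>
     (\<forall>c. \<forall>f\<in>l2 V. T (\<lambda>u. c * f u) = (\<lambda>u. c * T f u)) \<and>
     (\<exists>K. \<forall>f\<in>l2 V. l2_norm V (T f) \<le> K * l2_norm V f)"

definition adj_op :: "'a pair_pre_digraph \<Rightarrow> ('a \<Rightarrow> complex) \<Rightarrow> ('a \<Rightarrow> complex)" where
  "adj_op G f = (\<lambda>v. if v \<in> pverts G then (\<Sum>u\<in>nbrs G v. f u) else 0)"

definition adj_op_l2 :: "'a pair_pre_digraph \<Rightarrow> ('a \<Rightarrow> complex) \<Rightarrow> ('a \<Rightarrow> complex)" where
  "adj_op_l2 G = restrict (adj_op G) (l2 (pverts G))"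

text \<open>The operator \<open>T - z E\<close>.\<close>

definition shift_op ::
    "(('a \<Rightarrow> complex) \<Rightarrow> ('a \<Rightarrow> complex)) \<Rightarrow> complex \<Rightarrow> ('a \<Rightarrow> complex) \<Rightarrow> ('a \<Rightarrow> complex)" where
  "shift_op T z f = (\<lambda>u. T f u - z * f u)"

definition resolvent_set ::
    "'a set \<Rightarrow> (('a \<Rightarrow> complex) \<Rightarrow> ('a \<Rightarrow> complex)) \<Rightarrow> complex set" where
  "resolvent_set V T = {z. bij_betw (shift_op T z) (l2 V) (l2 V)}"

text \<open>Meaningful only for \<open>z\<close> in the resolvent set of \<open>adj_op_l2 G\<close>.\<close>

definition resolvent ::
    "'a pair_pre_digraph \<Rightarrow> complex \<Rightarrow> ('a \<Rightarrow> complex) \<Rightarrow> ('a \<Rightarrow> complex)" where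
  "resolvent G z = inv_into (l2 (pverts G)) (shift_op (adj_op_l2 G) z)"

definition delta :: "'a \<Rightarrow> 'a \<Rightarrow> complex" where
  "delta v = (\<lambda>u. if u = v then 1 else 0)"

definition propagator ::
    "'a pair_pre_digraph \<Rightarrow> complex \<Rightarrow> 'a \<Rightarrow> ('a \<Rightarrow> complex) \<Rightarrow> bool" where
  "propagator G z v f \<longleftrightarrow> f \<in> fun_space (pverts G) \<and> shift_op (adj_op G) z f = delta v"

definition num_walks :: "'a pair_pre_digraph \<Rightarrow> 'a \<Rightarrow> 'a \<Rightarrow> nat \<Rightarrow> nat" where
  "num_walks G v w n = card {p. pre_digraph.awalk (with_proj G) v p w \<and> length p = n}"

definition walk_term :: "'a pair_pre_digraph \<Rightarrow> complex \<Rightarrow> 'a \<Rightarrow> 'a \<Rightarrow> nat \<Rightarrow> complex" where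
  "walk_term G z v w n = of_nat (num_walks G v w n) * inverse z ^ n"

text \<open>Meaningful only where the series converges.\<close>

definition s_fun :: "'a pair_pre_digraph \<Rightarrow> complex \<Rightarrow> 'a \<Rightarrow> 'a \<Rightarrow> complex" where
  "s_fun G z v w = - inverse z * (\<Sum>n. walk_term G z v w n)"

definition s_tilde :: "'a pair_pre_digraph \<Rightarrow> complex \<Rightarrow> 'a \<Rightarrow> 'a \<Rightarrow> complex" where
  "s_tilde G z v w = resolvent G z (delta v) w"

end

theory Submission
  imports Defs
begin

text \<open>
  Write \<open>A\<close> for the adjacency operator on \<open>l2\<close>. Two estimates carry the argument:
  \<open>\<parallel>A f\<parallel> \<le> d \<parallel>f\<parallel>\<close> (\<open>adj_bound\<close>), and \<open>(A f, f)\<close> is real because the arcs come in opposite pairs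
  (\<open>adj_form_real\<close>).

  For \<open>z\<close> outside \<open>[-d, d]\<close> they yield a nonzero scalar \<open>b\<close> such that \<open>1 - b (A - z)\<close> is a
  contraction (\<open>contracts_outside\<close>). If \<open>|z| > d\<close>, take \<open>b = - 1 / z\<close>, so that the operator is
  \<open>A / z\<close>. If \<open>z\<close> is not real, take \<open>b\<close> small and imaginary: \<open>b (A - z)\<close> is then the sum of
  a positive real scalar and a skew-adjoint operator, and for small \<open>b\<close> the scalar wins, as it
  reduces the squared norm at first order while the skew part increases it only at second order.
  Every point outside \<open>[-d, d]\<close> falls under one of the two cases.

  The contraction gives at once a lower bound for \<open>A - z\<close>, hence injectivity and a bounded
  inverse (\<open>contracts_bounded_below\<close>), and surjectivity, through the iteration
  \<open>f \<mapsto> f - b ((A - z) f - g)\<close> started at \<open>0\<close> (\<open>iteration_solves\<close>). The iterates converge at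
  every vertex and are bounded in norm; since \<open>A\<close> involves only finite sums, the equation passes
  to the pointwise limit.

  Analyticity of the values of the resolvent follows from the resolvent identity and the local
  boundedness of the resolvent (\<open>R_analytic\<close>). When \<open>b = - 1 / z\<close> and \<open>g = delta v\<close>, the iterates
  are the partial sums of the series that counts walks (\<open>iter_step_walks\<close>), so the
  convergence of the iteration is both the convergence of the series and its identification with
  the resolvent.
\<close>

section \<open>The Hilbert space of square-summable functions\<close>

lemma l2_norm_nonneg [simp]: "0 \<le> l2_norm V f"
proof (cases "(\<lambda>u. f u * cnj (f u)) summable_on V")
  case True
  then have "Re (l2_inner V f f) = (\<Sum>\<^sub>\<infinity>u\<in>V. Re (f u * cnj (f u)))"
    unfolding l2_inner_def by (simp only: infsum_Re)
  also have "\<dots> \<ge> 0"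
    by (rule infsum_nonneg) simp
  finally show ?thesis
    by (simp add: l2_norm_def)
next
  case False
  then show ?thesis
    by (simp add: l2_norm_def l2_inner_def infsum_not_exists)
qed

lemma l2_norm_has_sum:
  assumes "f \<in> l2 V"
  shows "((\<lambda>u. (cmod (f u))\<^sup>2) has_sum (l2_norm V f)\<^sup>2) V"
proof -
  have s: "((\<lambda>u. (cmod (f u))\<^sup>2) has_sum (\<Sum>\<^sub>\<infinity>u\<in>V. (cmod (f u))\<^sup>2)) V"
    using assms by (simp add: l2_def)
  have "l2_inner V f f = of_real (\<Sum>\<^sub>\<infinity>u\<in>V. (cmod (f u))\<^sup>2)"
    unfolding l2_inner_def complex_norm_square[symmetric] by (rule infsumI[OF has_sum_of_real[OF s]])
  then have "(l2_norm V f)\<^sup>2 = (\<Sum>\<^sub>\<infinity>u\<in>V. (cmod (f u))\<^sup>2)"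
    unfolding l2_norm_def by (simp add: infsum_nonneg)
  with s show ?thesis
    by simp
qed

lemma L2_set_le_l2_norm:
  assumes "f \<in> l2 V" "finite F" "F \<subseteq> V"
  shows "L2_set (\<lambda>u. cmod (f u)) F \<le> l2_norm V f"
proof -
  have "(\<Sum>u\<in>F. (cmod (f u))\<^sup>2) \<le> (l2_norm V f)\<^sup>2"
    by (rule finite_sum_le_has_sum[OF l2_norm_has_sum]) (use assms in auto)
  then show ?thesis
    unfolding L2_set_def by (simp add: real_le_lsqrt)
qed

text \<open>
  The \<open>l2\<close> norm is the supremum of the Euclidean norms of the restrictions to finite sets.
  Every membership statement and every upper bound below is reduced in this way to finite
  sums, where the inequalities are known.
\<close>

lemma l2_if_finite_bound:
  assumes "f \<in> fun_space V"
    and B: "\<And>F. finite F \<Longrightarrow> F \<subseteq> V \<Longrightarrow> L2_set (\<lambda>u. cmod (f u)) F \<le> B"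
  shows "f \<in> l2 V" and "l2_norm V f \<le> B"
proof -
  have B0: "0 \<le> B"
    using B[of "{}"] by simp
  have sq: "(\<Sum>u\<in>F. (cmod (f u))\<^sup>2) \<le> B\<^sup>2" if "finite F" "F \<subseteq> V" for F
    using power_mono[OF B[OF that] L2_set_nonneg, of 2]
    by (simp add: L2_set_def sum_nonneg)
  have "(\<lambda>u. (cmod (f u))\<^sup>2) summable_on V"
    by (rule nonneg_bdd_above_summable_on) (auto intro!: bdd_aboveI2[where M = "B\<^sup>2"] sq)
  with assms(1) show f: "f \<in> l2 V"
    by (simp add: l2_def)
  have "(l2_norm V f)\<^sup>2 \<le> B\<^sup>2"
    using l2_norm_has_sum[OF f] sq by (rule has_sum_le_finite_sums)
  then show "l2_norm V f \<le> B"
    using B0 by (rule power2_le_imp_le)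
qed

lemma norm_le_l2_norm:
  assumes "f \<in> l2 V"
  shows "cmod (f u) \<le> l2_norm V f"
proof (cases "u \<in> V")
  case True
  then show ?thesis
    using L2_set_le_l2_norm[OF assms, of "{u}"] by simp
next
  case False
  then show ?thesis
    using assms by (simp add: l2_def fun_space_def)
qed

lemma l2_add:
  assumes f: "f \<in> l2 V" and g: "g \<in> l2 V"
  shows "(\<lambda>u. f u + g u) \<in> l2 V"
    and "l2_norm V (\<lambda>u. f u + g u) \<le> l2_norm V f + l2_norm V g"
proof -
  have fs: "(\<lambda>u. f u + g u) \<in> fun_space V"
    using f g by (simp add: l2_def fun_space_def)
  have "L2_set (\<lambda>u. cmod (f u + g u)) F \<le> l2_norm V f + l2_norm V g"
    if "finite F" "F \<subseteq> V" for F
  proof -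
    have "L2_set (\<lambda>u. cmod (f u + g u)) F \<le> L2_set (\<lambda>u. cmod (f u) + cmod (g u)) F"
      by (rule L2_set_mono) (auto intro: norm_triangle_ineq)
    also have "\<dots> \<le> L2_set (\<lambda>u. cmod (f u)) F + L2_set (\<lambda>u. cmod (g u)) F"
      by (rule L2_set_triangle_ineq)
    also have "\<dots> \<le> l2_norm V f + l2_norm V g"
      by (intro add_mono L2_set_le_l2_norm f g that)
    finally show ?thesis .
  qed
  from l2_if_finite_bound[OF fs this]
  show "(\<lambda>u. f u + g u) \<in> l2 V"
    and "l2_norm V (\<lambda>u. f u + g u) \<le> l2_norm V f + l2_norm V g" by auto
qed

lemma l2_scale:
  assumes f: "f \<in> l2 V"
  shows "(\<lambda>u. c * f u) \<in> l2 V"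
    and "l2_norm V (\<lambda>u. c * f u) = cmod c * l2_norm V f"
proof -
  have le: "(\<lambda>u. c * f u) \<in> l2 V \<and> l2_norm V (\<lambda>u. c * f u) \<le> cmod c * l2_norm V f"
    if f: "f \<in> l2 V" for c f
  proof -
    have fs: "(\<lambda>u. c * f u) \<in> fun_space V"
      using f by (simp add: l2_def fun_space_def)
    have "L2_set (\<lambda>u. cmod (c * f u)) F \<le> cmod c * l2_norm V f"
      if "finite F" "F \<subseteq> V" for F
      using mult_left_mono[OF L2_set_le_l2_norm[OF f that], of "cmod c"]
      by (simp add: norm_mult L2_set_right_distrib)
    from l2_if_finite_bound[OF fs this] show ?thesis by auto
  qed
  show "(\<lambda>u. c * f u) \<in> l2 V"
    using le[OF f] by blast
  show "l2_norm V (\<lambda>u. c * f u) = cmod c * l2_norm V f"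
  proof (cases "c = 0")
    case True
    then show ?thesis
      using le[OF f, of 0] l2_norm_nonneg[of V "\<lambda>u. 0"] by simp
  next
    case False
    have "l2_norm V f \<le> cmod (inverse c) * l2_norm V (\<lambda>u. c * f u)"
      using le[of "\<lambda>u. c * f u" "inverse c"] le[OF f, of c] False
      by (simp add: mult.assoc[symmetric])
    then show ?thesis
      using le[OF f, of c] False by (simp add: norm_divide field_simps)
  qed
qed

lemma l2_diff:
  assumes f: "f \<in> l2 V" and g: "g \<in> l2 V"
  shows "(\<lambda>u. f u - g u) \<in> l2 V"
    and "l2_norm V (\<lambda>u. f u - g u) \<le> l2_norm V f + l2_norm V g"
  using l2_add[OF f l2_scale(1)[OF g, of "-1"]] l2_scale(2)[OF g, of "-1"] by simp_all

lemma l2_zero: "(\<lambda>u. 0) \<in> l2 V"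
  by (simp add: l2_def fun_space_def)

lemma l2_norm_zero: "l2_norm V (\<lambda>u. 0) = 0"
  by (simp add: l2_norm_def l2_inner_def)

lemma l2_norm_zero_imp:
  assumes "f \<in> l2 V" "l2_norm V f \<le> 0"
  shows "f = (\<lambda>u. 0)"
  using order_trans[OF norm_le_l2_norm[OF assms(1)] assms(2)] by auto

lemma l2_if_finite_support:
  assumes "f \<in> fun_space V" "finite S" "\<And>u. u \<notin> S \<Longrightarrow> f u = 0"
  shows "f \<in> l2 V"
proof -
  have "(\<lambda>u. (cmod (f u))\<^sup>2) summable_on V"
    by (rule has_sum_imp_summable, rule has_sum_finite_neutralI[of "S \<inter> V"]) (use assms in auto)
  with assms(1) show ?thesis by (simp add: l2_def)
qed

lemma delta_in_l2: "v \<in> V \<Longrightarrow> delta v \<in> l2 V"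
  by (rule l2_if_finite_support[of _ _ "{v}"]) (auto simp: delta_def fun_space_def)

lemma l2_inner_delta:
  assumes "w \<in> V"
  shows "l2_inner V f (delta w) = f w"
  unfolding l2_inner_def
  by (rule infsumI, rule has_sum_finite_neutralI[of "{w}"]) (use assms in \<open>auto simp: delta_def\<close>)

text \<open>
  Fatou's lemma for sums: a norm-bounded sequence that converges at every vertex has its
  limit in \<open>l2\<close>, although it may fail to converge in norm.
\<close>

lemma l2_pointwise_limit:
  assumes x: "\<And>n. x n \<in> l2 V" and B: "\<And>n. l2_norm V (x n) \<le> B"
    and lim: "\<And>u. (\<lambda>n. x n u) \<longlonglongrightarrow> f u"
  shows "f \<in> l2 V"
proof (rule l2_if_finite_bound(1))
  show "f \<in> fun_space V"
    unfolding fun_space_def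
  proof (intro CollectI allI impI)
    fix u assume "u \<notin> V"
    then have "x n u = 0" for n
      using x[of n] by (simp add: l2_def fun_space_def)
    then show "f u = 0"
      using lim[of u] by (simp add: LIMSEQ_const_iff)
  qed
next
  fix F assume F: "finite F" "F \<subseteq> V"
  have "(\<lambda>n. L2_set (\<lambda>u. cmod (x n u)) F) \<longlonglongrightarrow> L2_set (\<lambda>u. cmod (f u)) F"
    unfolding L2_set_def by (intro tendsto_intros lim)
  then show "L2_set (\<lambda>u. cmod (f u)) F \<le> B"
    by (rule LIMSEQ_le_const2) (use order_trans[OF L2_set_le_l2_norm[OF x F] B] in blast)
qed

section \<open>The adjacency operator\<close>

locale bounded_degree_graph =
  fixes G :: "'a pair_pre_digraph" and d :: nat
  assumes bidirected: "pair_bidirected_digraph G"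
    and degrees: "degrees_le G d"
begin

abbreviation V :: "'a set" where "V \<equiv> pverts G"
abbreviation A :: "('a \<Rightarrow> complex) \<Rightarrow> 'a \<Rightarrow> complex" where "A \<equiv> adj_op G"
abbreviation T :: "complex \<Rightarrow> ('a \<Rightarrow> complex) \<Rightarrow> 'a \<Rightarrow> complex" where
  "T z \<equiv> shift_op (adj_op G) z"

lemma nbrs_sym: "u \<in> nbrs G v \<longleftrightarrow> v \<in> nbrs G u"
proof -
  interpret pair_bidirected_digraph G by (rule bidirected)
  show ?thesis
    using pair_sym_arcs by (auto simp: nbrs_def symmetric_def dest: symD)
qed

lemma nbrs_in_V: "u \<in> nbrs G v \<Longrightarrow> u \<in> V" "u \<in> nbrs G v \<Longrightarrow> v \<in> V"
proof -
  interpret pair_bidirected_digraph G by (rule bidirected)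
  show "u \<in> nbrs G v \<Longrightarrow> u \<in> V" "u \<in> nbrs G v \<Longrightarrow> v \<in> V"
    by (auto simp: nbrs_def dest: in_arcsD1 in_arcsD2)
qed

lemma finite_nbrs: "finite (nbrs G v)"
  using degrees nbrs_in_V(2)[of _ v] unfolding degrees_le_def
  by (cases "v \<in> V") (auto intro: finite_subset[of _ "{}"])

lemma card_nbrs: "card (nbrs G v) \<le> d"
proof (cases "v \<in> V")
  case False
  then have "nbrs G v = {}" using nbrs_in_V(2) by blast
  then show ?thesis by simp
qed (use degrees in \<open>auto simp: degrees_le_def\<close>)

text \<open>
  Cauchy-Schwarz at each vertex costs one factor \<open>d\<close>; the other one arises because every
  vertex is counted once for each of its neighbours.
\<close>

lemma adj_bound:
  assumes f: "f \<in> l2 V"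
  shows "A f \<in> l2 V" and "l2_norm V (A f) \<le> real d * l2_norm V f"
proof -
  have fs: "A f \<in> fun_space V"
    by (simp add: fun_space_def adj_op_def)
  have "L2_set (\<lambda>v. cmod (A f v)) F \<le> real d * l2_norm V f"
    if F: "finite F" "F \<subseteq> V" for F
  proof -
    define N where "N = (\<Union>v\<in>F. nbrs G v)"
    have N: "finite N" "N \<subseteq> V"
      unfolding N_def using F finite_nbrs nbrs_in_V by auto
    have point: "(cmod (A f v))\<^sup>2 \<le> real d * (\<Sum>u\<in>nbrs G v. (cmod (f u))\<^sup>2)" if "v \<in> F" for v
    proof -
      have "cmod (A f v) \<le> (\<Sum>u\<in>nbrs G v. \<bar>cmod (f u)\<bar> * \<bar>1\<bar>)"
        using that F by (auto simp: adj_op_def intro: norm_sum)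
      also have "\<dots> \<le> L2_set (\<lambda>u. cmod (f u)) (nbrs G v) * L2_set (\<lambda>u. 1) (nbrs G v)"
        by (rule L2_set_mult_ineq)
      finally have "(cmod (A f v))\<^sup>2
          \<le> (L2_set (\<lambda>u. cmod (f u)) (nbrs G v) * L2_set (\<lambda>u. 1) (nbrs G v))\<^sup>2"
        by (intro power_mono) auto
      also have "\<dots> = (\<Sum>u\<in>nbrs G v. (cmod (f u))\<^sup>2) * real (card (nbrs G v))"
        by (simp add: L2_set_def power_mult_distrib sum_nonneg)
      also have "\<dots> \<le> (\<Sum>u\<in>nbrs G v. (cmod (f u))\<^sup>2) * real d"
        using card_nbrs by (intro mult_left_mono) (auto intro: sum_nonneg)
      finally show ?thesis by (simp add: mult.commute)
    qed
    have "(\<Sum>v\<in>F. \<Sum>u\<in>nbrs G v. (cmod (f u))\<^sup>2)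
        = (\<Sum>v\<in>F. \<Sum>u | u \<in> N \<and> u \<in> nbrs G v. (cmod (f u))\<^sup>2)"
      by (intro sum.cong) (auto simp: N_def)
    also have "\<dots> = (\<Sum>u\<in>N. \<Sum>v | v \<in> F \<and> u \<in> nbrs G v. (cmod (f u))\<^sup>2)"
      using F N by (intro sum.swap_restrict)
    also have "\<dots> \<le> (\<Sum>u\<in>N. real d * (cmod (f u))\<^sup>2)"
    proof (intro sum_mono)
      fix u
      have "card {v. v \<in> F \<and> u \<in> nbrs G v} \<le> card (nbrs G u)"
        by (intro card_mono finite_nbrs) (auto simp: nbrs_sym[of u])
      then have "card {v. v \<in> F \<and> u \<in> nbrs G v} \<le> d"
        using card_nbrs[of u] by linarith
      then show "(\<Sum>v | v \<in> F \<and> u \<in> nbrs G v. (cmod (f u))\<^sup>2) \<le> real d * (cmod (f u))\<^sup>2"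
        by (simp add: mult_right_mono)
    qed
    also have "\<dots> = real d * (L2_set (\<lambda>u. cmod (f u)) N)\<^sup>2"
      by (simp add: L2_set_def sum_distrib_left sum_nonneg)
    also have "\<dots> \<le> real d * (l2_norm V f)\<^sup>2"
      using L2_set_le_l2_norm[OF f N] by (intro mult_left_mono power_mono) auto
    finally have "(\<Sum>v\<in>F. \<Sum>u\<in>nbrs G v. (cmod (f u))\<^sup>2) \<le> real d * (l2_norm V f)\<^sup>2" .
    then have "real d * (\<Sum>v\<in>F. \<Sum>u\<in>nbrs G v. (cmod (f u))\<^sup>2)
        \<le> real d * (real d * (l2_norm V f)\<^sup>2)"
      by (rule mult_left_mono) simp
    moreover have "(\<Sum>v\<in>F. (cmod (A f v))\<^sup>2)
        \<le> real d * (\<Sum>v\<in>F. \<Sum>u\<in>nbrs G v. (cmod (f u))\<^sup>2)"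
      unfolding sum_distrib_left[of _ _ F] by (intro sum_mono point)
    ultimately have "(\<Sum>v\<in>F. (cmod (A f v))\<^sup>2) \<le> (real d * l2_norm V f)\<^sup>2"
      by (simp add: power2_eq_square algebra_simps)
    then show ?thesis
      unfolding L2_set_def by (intro real_le_lsqrt) simp_all
  qed
  from l2_if_finite_bound[OF fs this]
  show "A f \<in> l2 V" and "l2_norm V (A f) \<le> real d * l2_norm V f" by auto
qed

text \<open>
  The form \<open>(A f, f)\<close> is real: it is a sum over arcs, and reversing an arc conjugates its term.
  Absolute summability over the arcs, which lets the order of summation change, uses that every
  vertex is the tail of at most \<open>d\<close> arcs and the head of at most \<open>d\<close> arcs.
\<close>

lemma adj_form_real:
  assumes f: "f \<in> l2 V"
  shows "((\<lambda>v. Im (cnj (f v) * A f v)) has_sum 0) V"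
proof -
  define E where "E = Sigma V (nbrs G)"
  define a where "a = (\<lambda>(v, u). Im (cnj (f v) * f u))"
  have swap: "(\<lambda>e. h (prod.swap e)) summable_on E \<longleftrightarrow> h summable_on E"
    for h :: "'a \<times> 'a \<Rightarrow> real"
    by (rule summable_on_reindex_bij_witness[of _ prod.swap prod.swap])
      (use nbrs_sym nbrs_in_V in \<open>auto simp: E_def\<close>)
  have tail: "(\<lambda>e. (cmod (f (fst e)))\<^sup>2) summable_on E"
    unfolding E_def
  proof (rule summable_on_SigmaI)
    show "((\<lambda>u. (cmod (f (fst (v, u))))\<^sup>2) has_sum (real (card (nbrs G v)) * (cmod (f v))\<^sup>2)) (nbrs G v)"
      for v
      using has_sum_finite[OF finite_nbrs, of "\<lambda>u. (cmod (f v))\<^sup>2" v] by simp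
    show "(\<lambda>v. real (card (nbrs G v)) * (cmod (f v))\<^sup>2) summable_on V"
    proof (rule summable_on_comparison_test)
      show "(\<lambda>v. real d * (cmod (f v))\<^sup>2) summable_on V"
        using f by (intro summable_on_cmult_right) (simp add: l2_def)
    qed (use card_nbrs in \<open>auto intro: mult_right_mono\<close>)
  qed auto
  then have head: "(\<lambda>e. (cmod (f (snd e)))\<^sup>2) summable_on E"
    using swap[of "\<lambda>e. (cmod (f (fst e)))\<^sup>2"] by simp
  have "(\<lambda>e. norm (a e)) summable_on E"
  proof (rule Infinite_Sum.abs_summable_on_comparison_test')
    show "(\<lambda>e. (cmod (f (fst e)))\<^sup>2 + (cmod (f (snd e)))\<^sup>2) summable_on E"
      using tail head by (rule summable_on_add)
    fix e
    have "norm (a e) \<le> cmod (f (fst e)) * cmod (f (snd e))"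
      using abs_Im_le_cmod[of "cnj (f (fst e)) * f (snd e)"]
      by (simp add: a_def case_prod_unfold norm_mult)
    also have "\<dots> \<le> (cmod (f (fst e)))\<^sup>2 + (cmod (f (snd e)))\<^sup>2"
      using sum_squares_bound[of "cmod (f (fst e))" "cmod (f (snd e))"]
        mult_nonneg_nonneg[OF norm_ge_zero norm_ge_zero, of "f (fst e)" "f (snd e)"]
      by linarith
    finally show "norm (a e) \<le> (cmod (f (fst e)))\<^sup>2 + (cmod (f (snd e)))\<^sup>2" .
  qed
  then have "a summable_on E"
    by (rule abs_summable_summable)
  then obtain S where S: "(a has_sum S) E"
    by (auto simp: summable_on_def)
  have "(a has_sum S) E \<longleftrightarrow> ((\<lambda>e. - a e) has_sum S) E"
    by (rule has_sum_reindex_bij_witness[of _ prod.swap prod.swap])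
      (use nbrs_sym nbrs_in_V in \<open>auto simp: E_def a_def\<close>)
  then have "S = - S"
    using S has_sum_uminusI[OF S] has_sum_unique by blast
  then have "(a has_sum 0) (Sigma V (nbrs G))"
    using S by (simp add: E_def)
  moreover have "((\<lambda>u. a (v, u)) has_sum Im (cnj (f v) * A f v)) (nbrs G v)" if "v \<in> V" for v
  proof -
    have "Im (cnj (f v) * A f v) = (\<Sum>u\<in>nbrs G v. a (v, u))"
      using that by (simp only: adj_op_def if_True sum_distrib_left Im_sum a_def case_prod_conv)
    then show ?thesis
      using has_sum_finite[OF finite_nbrs] by simp
  qed
  ultimately show ?thesis
    by (rule has_sum_SigmaD)
qed

section \<open>Solving the resolvent equation\<close>

lemma T_l2:
  assumes "f \<in> l2 V"
  shows "T z f \<in> l2 V"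
  unfolding shift_op_def by (intro l2_diff adj_bound l2_scale assms)

lemma T_add: "T z (\<lambda>u. f u + g u) = (\<lambda>u. T z f u + T z g u)"
  by (auto simp: shift_op_def adj_op_def sum.distrib algebra_simps)

lemma T_scale: "T z (\<lambda>u. c * f u) = (\<lambda>u. c * T z f u)"
  by (auto simp: shift_op_def adj_op_def sum_distrib_left algebra_simps)

lemma T_diff: "T z (\<lambda>u. f u - g u) = (\<lambda>u. T z f u - T z g u)"
  using T_add[of z f "\<lambda>u. -1 * g u"] T_scale[of z "-1" g] by simp

text \<open>
  A scalar \<open>b\<close> for which \<open>1 - b (A - z)\<close> is a contraction plays the role of a preconditioner:
  the equation \<open>(A - z) f = g\<close> becomes the fixed point equation of the iteration
  \<open>f \<mapsto> f - b ((A - z) f - g)\<close>. A contraction constant also gives a lower bound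
  for \<open>A - z\<close>, hence injectivity and a bounded inverse.
\<close>

definition contracts :: "complex \<Rightarrow> complex \<Rightarrow> real \<Rightarrow> bool" where
  "contracts z b q \<longleftrightarrow> b \<noteq> 0 \<and> 0 \<le> q \<and> q < 1 \<and>
     (\<forall>h\<in>l2 V. l2_norm V (\<lambda>u. h u - b * T z h u) \<le> q * l2_norm V h)"

definition iter_step :: "complex \<Rightarrow> complex \<Rightarrow> ('a \<Rightarrow> complex) \<Rightarrow> ('a \<Rightarrow> complex) \<Rightarrow> 'a \<Rightarrow> complex" where
  "iter_step z b g f = (\<lambda>u. f u - b * (T z f u - g u))"

lemma contracts_far:
  assumes "cmod z > real d"
  shows "contracts z (- inverse z) (real d / cmod z)"
proof -
  have z: "z \<noteq> 0"
    using assms by auto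
  have "l2_norm V (\<lambda>u. h u - - inverse z * T z h u) \<le> real d / cmod z * l2_norm V h"
    if h: "h \<in> l2 V" for h
  proof -
    have "(\<lambda>u. h u - - inverse z * T z h u) = (\<lambda>u. inverse z * A h u)"
      using z by (auto simp: shift_op_def field_simps)
    then have "l2_norm V (\<lambda>u. h u - - inverse z * T z h u) = inverse (cmod z) * l2_norm V (A h)"
      using l2_scale(2)[OF adj_bound(1)[OF h]] by (simp add: norm_inverse)
    also have "\<dots> \<le> inverse (cmod z) * (real d * l2_norm V h)"
      using adj_bound(2)[OF h] by (intro mult_left_mono) auto
    finally show ?thesis
      by (simp add: field_simps)
  qed
  then show ?thesis
    using z assms by (auto simp: contracts_def)
qed

text \<open>
  With \<open>b = \<i> s\<close>, \<open>s\<close> real,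
  \<open>h - b (A - z) h = (1 - s y) h + \<i> s (Re z - A) h\<close>, where \<open>y = Im z\<close>. Since \<open>((Re z - A) h, h)\<close> is real,
  the two summands are orthogonal for the real part of the inner product, so the squared norm
  is at most \<open>(1 - s y)\<^sup>2 + (s M)\<^sup>2\<close> times that of \<open>h\<close>, where
  \<open>M = \<bar>Re z\<bar> + d\<close>. The minimum over \<open>s\<close> is \<open>M\<^sup>2 / (M\<^sup>2 + y\<^sup>2) < 1\<close>.
\<close>

lemma contracts_nonreal:
  assumes y0: "Im z \<noteq> 0"
  shows "\<exists>b q. contracts z b q"
proof -
  define x where "x = Re z"
  define y where "y = Im z"
  define M where "M = \<bar>x\<bar> + real d"
  define D where "D = M\<^sup>2 + y\<^sup>2"
  define s where "s = y / D"
  define a where "a = 1 - s * y"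
  define q where "q = sqrt (M\<^sup>2 / D)"
  have D: "D > 0" "D > M\<^sup>2"
    using y0 by (auto simp: D_def y_def add_nonneg_pos)
  have s0: "s \<noteq> 0"
    using y0 D by (simp add: s_def y_def)
  have M0: "M \<ge> 0"
    by (simp add: M_def)
  have q: "a\<^sup>2 + s\<^sup>2 * M\<^sup>2 = q\<^sup>2"
  proof -
    have aD: "a = M\<^sup>2 / D"
    proof -
      have "a * D = D - (s * D) * y"
        by (simp add: a_def algebra_simps)
      also have "\<dots> = M\<^sup>2"
        using D by (simp add: s_def) (simp add: D_def power2_eq_square)
      finally show ?thesis
        using D by (simp add: eq_divide_eq)
    qed
    have "a\<^sup>2 + s\<^sup>2 * M\<^sup>2 = M\<^sup>2 * (M\<^sup>2 + y\<^sup>2) / D\<^sup>2"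
      unfolding aD s_def by (simp add: add_divide_distrib[symmetric] power2_eq_square algebra_simps)
    also have "\<dots> = M\<^sup>2 / D"
      unfolding D_def[symmetric] using D by (simp add: power2_eq_square)
    finally show ?thesis
      using D by (simp add: q_def)
  qed
  have "l2_norm V (\<lambda>u. h u - (\<i> * s) * T z h u) \<le> q * l2_norm V h" if h: "h \<in> l2 V" for h
  proof -
    define c where "c = (\<lambda>u. x * h u - A h u)"
    have c: "c \<in> l2 V"
      unfolding c_def by (intro l2_diff l2_scale adj_bound h)
    have "l2_norm V c \<le> \<bar>x\<bar> * l2_norm V h + real d * l2_norm V h"
      unfolding c_def
      using l2_diff(2)[OF l2_scale(1)[OF h, of x] adj_bound(1)[OF h]] l2_scale(2)[OF h, of x]
        adj_bound(2)[OF h] by simp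
    then have cM: "l2_norm V c \<le> M * l2_norm V h"
      by (simp add: M_def algebra_simps)
    define k where "k = (\<lambda>u. h u - (\<i> * s) * T z h u)"
    have k: "k \<in> l2 V"
      unfolding k_def by (intro l2_diff l2_scale T_l2 h)
    have "z = complex_of_real x + \<i> * complex_of_real y"
      by (simp add: x_def y_def complex_eq_iff)
    then have k_eq: "k u = complex_of_real a * h u + \<i> * complex_of_real s * c u" for u
      by (simp add: k_def c_def a_def shift_op_def algebra_simps)
    have expand: "(cmod (k u))\<^sup>2
        = a\<^sup>2 * (cmod (h u))\<^sup>2 + s\<^sup>2 * (cmod (c u))\<^sup>2 + 2 * a * s * Im (cnj (h u) * A h u)" for u
      unfolding k_eq c_def cmod_power2 by (simp add: power2_eq_square algebra_simps)
    have "((\<lambda>u. (cmod (k u))\<^sup>2) has_sum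
        a\<^sup>2 * (l2_norm V h)\<^sup>2 + s\<^sup>2 * (l2_norm V c)\<^sup>2 + 2 * a * s * 0) V"
      unfolding expand
      by (intro has_sum_add has_sum_cmult_right l2_norm_has_sum adj_form_real h c)
    then have "(l2_norm V k)\<^sup>2 = a\<^sup>2 * (l2_norm V h)\<^sup>2 + s\<^sup>2 * (l2_norm V c)\<^sup>2"
      using has_sum_unique[OF l2_norm_has_sum[OF k]] by simp
    also have "\<dots> \<le> a\<^sup>2 * (l2_norm V h)\<^sup>2 + s\<^sup>2 * (M * l2_norm V h)\<^sup>2"
      using cM by (intro add_left_mono mult_left_mono power_mono) auto
    also have "\<dots> = (q * l2_norm V h)\<^sup>2"
      by (simp add: power_mult_distrib q[symmetric] algebra_simps)
    finally have "l2_norm V k \<le> q * l2_norm V h"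
      by (rule power2_le_imp_le) (use D in \<open>simp add: q_def\<close>)
    then show ?thesis
      by (simp add: k_def)
  qed
  moreover have "q < 1" "0 \<le> q"
    using D by (auto simp: q_def)
  ultimately have "contracts z (\<i> * s) q"
    using s0 by (auto simp: contracts_def)
  then show ?thesis by blast
qed

lemma contracts_outside:
  assumes "z \<in> - (complex_of_real ` {- real d..real d})"
  shows "\<exists>b q. contracts z b q"
proof (cases "Im z = 0")
  case True
  then have z: "z = complex_of_real (Re z)"
    by (simp add: complex_eq_iff)
  then have "Re z \<notin> {- real d..real d}"
    using assms by blast
  moreover have "cmod z = \<bar>Re z\<bar>"
    by (subst z) (rule norm_of_real)
  ultimately have "cmod z > real d"
    by auto
  then show ?thesis
    using contracts_far by blast
qed (use contracts_nonreal in blast)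

text \<open>The triangle inequality applied to \<open>h = (h - b (A - z) h) + b (A - z) h\<close>.\<close>

lemma contracts_bounded_below:
  assumes c: "contracts z b q"
  shows "\<exists>c>0. \<forall>h\<in>l2 V. c * l2_norm V h \<le> l2_norm V (T z h)"
proof (intro exI conjI ballI)
  show "(1 - q) / cmod b > 0"
    using c by (simp add: contracts_def)
  fix h assume h: "h \<in> l2 V"
  have bT: "(\<lambda>u. b * T z h u) \<in> l2 V"
    by (intro l2_scale T_l2 h)
  have "l2_norm V h \<le> l2_norm V (\<lambda>u. h u - b * T z h u) + l2_norm V (\<lambda>u. b * T z h u)"
    using l2_add(2)[OF l2_diff(1)[OF h bT] bT] by simp
  also have "\<dots> \<le> q * l2_norm V h + cmod b * l2_norm V (T z h)"
    using c h l2_scale(2)[OF T_l2[OF h]] by (simp add: contracts_def)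
  finally show "(1 - q) / cmod b * l2_norm V h \<le> l2_norm V (T z h)"
    using c by (simp add: contracts_def field_simps)
qed

text \<open>
  Consecutive iterates differ by at most a multiple of \<open>q ^ n\<close> in norm, hence at every vertex.
  The pointwise limit solves the equation because each value of \<open>A f\<close> is a finite sum, and it
  is square-summable because the iterates are bounded in norm. Keeping the limit explicit, rather
  than only the existence of a solution, is what identifies the walk series later.
\<close>

lemma iteration_solves:
  assumes c: "contracts z b q" and g: "g \<in> l2 V"
  shows "\<exists>f\<in>l2 V. T z f = g \<and> (\<forall>u. (\<lambda>n. (iter_step z b g ^^ n) (\<lambda>u. 0) u) \<longlonglongrightarrow> f u)"
proof -
  define x where "x = (\<lambda>n. (iter_step z b g ^^ n) (\<lambda>u. 0))"
  define K where "K = l2_norm V (\<lambda>u. b * g u)"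
  have q: "0 \<le> q" "q < 1" and b: "b \<noteq> 0"
    and contr: "h \<in> l2 V \<Longrightarrow> l2_norm V (\<lambda>u. h u - b * T z h u) \<le> q * l2_norm V h" for h
    using c by (auto simp: contracts_def)
  have x0: "x 0 = (\<lambda>u. 0)"
    by (simp add: x_def)
  have xS: "x (Suc n) = (\<lambda>u. x n u - b * (T z (x n) u - g u))" for n
    by (simp add: x_def iter_step_def)
  have bg: "(\<lambda>u. b * g u) \<in> l2 V"
    by (intro l2_scale g)
  have bound: "x n \<in> l2 V \<and> l2_norm V (x n) \<le> K / (1 - q)" for n
  proof (induction n)
    case 0
    show ?case
      using q by (simp add: x0 K_def l2_zero l2_norm_zero)
  next
    case (Suc n)
    have h: "(\<lambda>u. x n u - b * T z (x n) u) \<in> l2 V"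
      using Suc by (intro l2_diff l2_scale T_l2) auto
    have eq: "x (Suc n) = (\<lambda>u. (x n u - b * T z (x n) u) + b * g u)"
      by (simp add: xS algebra_simps)
    have "l2_norm V (x (Suc n)) \<le> l2_norm V (\<lambda>u. x n u - b * T z (x n) u) + K"
      unfolding eq K_def by (rule l2_add(2)[OF h bg])
    also have "\<dots> \<le> q * l2_norm V (x n) + K"
      using contr Suc by simp
    also have "\<dots> \<le> q * (K / (1 - q)) + K"
      using Suc q by (intro add_right_mono mult_left_mono) auto
    also have "\<dots> = K / (1 - q)"
      using q by (simp add: field_simps)
    finally show ?case
      using l2_add(1)[OF h bg] by (simp add: eq)
  qed
  define e where "e = (\<lambda>n u. x (Suc n) u - x n u)"
  have e: "e n \<in> l2 V \<and> l2_norm V (e n) \<le> q ^ n * K" for n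
  proof (induction n)
    case 0
    have "e 0 = (\<lambda>u. b * g u)"
      using T_scale[of z 0] by (simp add: e_def xS x0 fun_eq_iff)
    then show ?case
      using bg by (simp add: K_def)
  next
    case (Suc n)
    have eS: "e (Suc n) = (\<lambda>u. e n u - b * T z (e n) u)"
    proof
      fix u
      have diff: "e m u = - b * (T z (x m) u - g u)" for m
        by (simp add: e_def fun_cong[OF xS])
      have T_e: "T z (e n) u = T z (x (Suc n)) u - T z (x n) u"
        by (simp add: e_def T_diff)
      show "e (Suc n) u = e n u - b * T z (e n) u"
        unfolding diff T_e by (simp add: algebra_simps)
    qed
    have "l2_norm V (e (Suc n)) \<le> q * l2_norm V (e n)"
      unfolding eS using contr Suc by blast
    also have "\<dots> \<le> q * (q ^ n * K)"
      using Suc q by (intro mult_left_mono) auto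
    finally have "l2_norm V (e (Suc n)) \<le> q ^ Suc n * K"
      by simp
    moreover have "e (Suc n) \<in> l2 V"
      unfolding eS using Suc by (intro l2_diff l2_scale T_l2) auto
    ultimately show ?case by blast
  qed
  have "convergent (\<lambda>n. x n u)" for u
  proof -
    have "summable (\<lambda>n. e n u)"
    proof (rule summable_comparison_test')
      show "summable (\<lambda>n. q ^ n * K)"
        using q by (intro summable_mult2 summable_geometric) simp
      show "norm (e n u) \<le> q ^ n * K" for n
        using norm_le_l2_norm[of "e n" V u] e[of n] by linarith
    qed
    moreover have "(\<Sum>i<n. e i u) = x n u" for n
      unfolding e_def by (subst sum_lessThan_telescope) (simp add: x0)
    ultimately show ?thesis
      by (simp add: summable_iff_convergent)
  qed
  then have "\<forall>u. \<exists>l. (\<lambda>n. x n u) \<longlonglongrightarrow> l"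
    by (simp add: convergent_def)
  then obtain f where lim: "\<And>u. (\<lambda>n. x n u) \<longlonglongrightarrow> f u"
    by metis
  have f: "f \<in> l2 V"
    using bound by (intro l2_pointwise_limit[OF _ _ lim]) auto
  have "T z f u = g u" for u
  proof -
    have "(\<lambda>n. A (x n) u) \<longlonglongrightarrow> A f u"
      by (cases "u \<in> V") (auto simp: adj_op_def intro!: tendsto_intros lim)
    then have "(\<lambda>n. x (Suc n) u) \<longlonglongrightarrow> f u - b * (T z f u - g u)"
      unfolding xS shift_op_def by (intro tendsto_intros lim)
    moreover have "(\<lambda>n. x (Suc n) u) \<longlonglongrightarrow> f u"
      using lim by (rule LIMSEQ_Suc)
    ultimately have "f u - b * (T z f u - g u) = f u"
      by (rule LIMSEQ_unique)
    then show ?thesis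
      using b by simp
  qed
  then show ?thesis
    using f lim unfolding x_def by blast
qed

section \<open>The resolvent\<close>

abbreviation \<Omega> :: "complex set" where "\<Omega> \<equiv> - (complex_of_real ` {- real d..real d})"
abbreviation R :: "complex \<Rightarrow> ('a \<Rightarrow> complex) \<Rightarrow> 'a \<Rightarrow> complex" where "R \<equiv> resolvent G"

lemma T_inj:
  assumes z: "z \<in> \<Omega>" and f: "f \<in> l2 V" "f' \<in> l2 V" and eq: "T z f = T z f'"
  shows "f = f'"
proof -
  obtain c where c: "c > 0" "\<forall>h\<in>l2 V. c * l2_norm V h \<le> l2_norm V (T z h)"
    using contracts_outside[OF z] contracts_bounded_below by blast
  have d: "(\<lambda>u. f u - f' u) \<in> l2 V"
    using f by (rule l2_diff)
  have "T z (\<lambda>u. f u - f' u) = (\<lambda>u. 0)"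
    by (simp add: T_diff eq)
  then have "c * l2_norm V (\<lambda>u. f u - f' u) \<le> 0"
    using c(2) d by (force simp: l2_norm_zero)
  then have "l2_norm V (\<lambda>u. f u - f' u) \<le> 0"
    using c(1) by (simp add: mult_le_0_iff)
  then show ?thesis
    using l2_norm_zero_imp[OF d] by (simp add: fun_eq_iff)
qed

lemma T_bij:
  assumes z: "z \<in> \<Omega>"
  shows "bij_betw (T z) (l2 V) (l2 V)"
proof (rule bij_betwI')
  fix g assume "g \<in> l2 V"
  then show "\<exists>f\<in>l2 V. g = T z f"
    using contracts_outside[OF z] iteration_solves by metis
qed (use T_inj[OF z] T_l2 in auto)

lemma shift_adj_op_l2: "f \<in> l2 V \<Longrightarrow> shift_op (adj_op_l2 G) z f = T z f"
  by (simp add: shift_op_def adj_op_l2_def)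

lemma bij_adj_op_l2: "z \<in> \<Omega> \<Longrightarrow> bij_betw (shift_op (adj_op_l2 G) z) (l2 V) (l2 V)"
  using T_bij[of z] by (simp add: shift_adj_op_l2 cong: bij_betw_cong)

lemma R_l2:
  assumes "z \<in> \<Omega>" "g \<in> l2 V"
  shows "R z g \<in> l2 V" and "T z (R z g) = g"
proof -
  have img: "g \<in> shift_op (adj_op_l2 G) z ` l2 V"
    using bij_adj_op_l2[OF assms(1)] assms(2) by (simp add: bij_betw_def)
  show l: "R z g \<in> l2 V"
    unfolding resolvent_def by (rule inv_into_into[OF img])
  show "T z (R z g) = g"
    using f_inv_into_f[OF img] shift_adj_op_l2[OF l] by (simp add: resolvent_def)
qed

lemma R_unique:
  assumes "z \<in> \<Omega>" "f \<in> l2 V" "T z f = g"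
  shows "R z g = f"
proof -
  have g: "g \<in> l2 V"
    using T_l2[OF assms(2)] assms(3) by auto
  show ?thesis
    by (rule T_inj[OF assms(1) R_l2(1)[OF assms(1) g] assms(2)])
      (simp add: R_l2(2)[OF assms(1) g] assms(3))
qed

lemma R_add:
  assumes "z \<in> \<Omega>" "f \<in> l2 V" "g \<in> l2 V"
  shows "R z (\<lambda>u. f u + g u) = (\<lambda>u. R z f u + R z g u)"
  by (rule R_unique) (use assms in \<open>simp_all add: R_l2 l2_add T_add\<close>)

lemma R_scale:
  assumes "z \<in> \<Omega>" "f \<in> l2 V"
  shows "R z (\<lambda>u. c * f u) = (\<lambda>u. c * R z f u)"
  by (rule R_unique) (use assms in \<open>simp_all add: R_l2 l2_scale T_scale\<close>)

text \<open>
  A lower bound \<open>c\<close> for \<open>A - z\<close> is one of \<open>c / 2\<close> for \<open>A - z'\<close> when \<open>|z' - z| \<le> c / 2\<close>, so the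
  resolvent is bounded uniformly near each point.
\<close>

lemma R_locally_bounded:
  assumes z: "z \<in> \<Omega>"
  shows "\<exists>c>0. \<forall>z'\<in>\<Omega>. cmod (z' - z) \<le> c \<longrightarrow> (\<forall>g\<in>l2 V. l2_norm V (R z' g) \<le> l2_norm V g / c)"
proof -
  obtain c where c: "c > 0" "\<And>h. h \<in> l2 V \<Longrightarrow> c * l2_norm V h \<le> l2_norm V (T z h)"
    using contracts_outside[OF z] contracts_bounded_below by blast
  have "l2_norm V (R z' g) \<le> l2_norm V g / (c / 2)"
    if z': "z' \<in> \<Omega>" "cmod (z' - z) \<le> c / 2" and g: "g \<in> l2 V" for z' g
  proof -
    define h where "h = R z' g"
    have h: "h \<in> l2 V" and Th: "T z' h = g"
      using R_l2[OF z'(1) g] by (auto simp: h_def)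
    have "T z h = (\<lambda>u. g u + (z' - z) * h u)"
      unfolding Th[symmetric] by (simp add: shift_op_def algebra_simps)
    then have "l2_norm V (T z h) \<le> l2_norm V g + cmod (z' - z) * l2_norm V h"
      using l2_add(2)[OF g l2_scale(1)[OF h]] l2_scale(2)[OF h] by metis
    also have "\<dots> \<le> l2_norm V g + c / 2 * l2_norm V h"
      using z' by (intro add_left_mono mult_right_mono) auto
    finally show ?thesis
      using c(2)[OF h] c(1) by (simp add: h_def field_simps)
  qed
  then show ?thesis
    using c(1) by (intro exI[of _ "c / 2"]) auto
qed

lemma R_bounded_linear:
  assumes z: "z \<in> \<Omega>"
  shows "bounded_linear_on_l2 V (R z)"
proof -
  obtain c where c: "c > 0" "\<And>g. g \<in> l2 V \<Longrightarrow> l2_norm V (R z g) \<le> l2_norm V g / c"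
    using R_locally_bounded[OF z] z by force
  then have "\<exists>K. \<forall>f\<in>l2 V. l2_norm V (R z f) \<le> K * l2_norm V f"
    by (intro exI[of _ "1 / c"]) simp
  then show ?thesis
    unfolding bounded_linear_on_l2_def using R_l2(1) R_add R_scale z by blast
qed

lemma resolvent_identity:
  assumes z: "z \<in> \<Omega>" "z' \<in> \<Omega>" and g: "g \<in> l2 V"
  shows "R z' g u - R z g u = (z' - z) * R z' (R z g) u"
proof -
  have "R z' g = (\<lambda>u. R z g u + (z' - z) * R z' (R z g) u)"
  proof (rule R_unique[OF z(2)])
    show "(\<lambda>u. R z g u + (z' - z) * R z' (R z g) u) \<in> l2 V"
      by (intro l2_add l2_scale R_l2 z g)
    have "T z' (R z g) = (\<lambda>u. g u - (z' - z) * R z g u)"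
      by (subst R_l2(2)[OF z(1) g, symmetric]) (simp add: shift_op_def algebra_simps)
    then show "T z' (\<lambda>u. R z g u + (z' - z) * R z' (R z g) u) = g"
      by (simp add: T_add T_scale R_l2[OF z(2) R_l2(1)[OF z(1) g]])
  qed
  from fun_cong[OF this, of u] show ?thesis
    by simp
qed

lemma open_\<Omega>: "open \<Omega>"
  by (intro open_Compl compact_imp_closed compact_continuous_image continuous_intros) simp

text \<open>
  The increment \<open>R z' g - R z g\<close> is \<open>z' - z\<close> times the locally bounded \<open>R z' (R z g)\<close>.
\<close>

lemma R_continuous:
  assumes z: "z \<in> \<Omega>" and g: "g \<in> l2 V"
  shows "((\<lambda>z'. R z' g w) \<longlongrightarrow> R z g w) (at z)"
proof -
  obtain c where c: "c > 0"
    "\<And>z' g. z' \<in> \<Omega> \<Longrightarrow> cmod (z' - z) \<le> c \<Longrightarrow> g \<in> l2 V \<Longrightarrow> l2_norm V (R z' g) \<le> l2_norm V g / c"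
    using R_locally_bounded[OF z] by blast
  define K where "K = l2_norm V (R z g) / c"
  have ev: "\<forall>\<^sub>F z' in at z. cmod (R z' g w - R z g w) \<le> cmod (z' - z) * K"
  proof -
    have "\<forall>\<^sub>F z' in at z. z' \<in> \<Omega>"
      using open_\<Omega> z eventually_at_in_open' by blast
    moreover have "\<forall>\<^sub>F z' in at z. cmod (z' - z) \<le> c"
      using c(1) by (auto simp: eventually_at dist_norm intro!: exI[of _ c])
    ultimately show ?thesis
    proof eventually_elim
      case (elim z')
      have "cmod (R z' (R z g) w) \<le> K"
        using norm_le_l2_norm[OF R_l2(1)[OF elim(1) R_l2(1)[OF z g]], of w]
          c(2)[OF elim R_l2(1)[OF z g]] by (simp add: K_def)
      then show ?case
        unfolding resolvent_identity[OF z elim(1) g] norm_mult by (intro mult_left_mono) auto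
    qed
  qed
  have "((\<lambda>z'. cmod (z' - z) * K) \<longlongrightarrow> cmod (z - z) * K) (at z)"
    by (intro tendsto_intros)
  then have "((\<lambda>z'. cmod (z' - z) * K) \<longlongrightarrow> 0) (at z)"
    by simp
  then have "((\<lambda>z'. R z' g w - R z g w) \<longlongrightarrow> 0) (at z)"
    by (rule Lim_null_comparison[OF ev])
  then show ?thesis
    by (simp add: LIM_zero_iff)
qed

text \<open>
  The difference quotient at \<open>z\<close> is the value of \<open>R z' (R z g)\<close>, to which continuity applies again.
\<close>

lemma R_analytic:
  assumes g: "g \<in> l2 V"
  shows "(\<lambda>z. R z g w) analytic_on \<Omega>"
proof -
  have "((\<lambda>z. R z g w) has_field_derivative R z (R z g) w) (at z)" if z: "z \<in> \<Omega>" for z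
  proof -
    have "\<forall>\<^sub>F z' in at z. z' \<in> \<Omega>"
      using open_\<Omega> z eventually_at_in_open' by blast
    then have "\<forall>\<^sub>F z' in at z. z' \<in> \<Omega> \<and> z' \<noteq> z"
      by (simp add: eventually_conj eventually_neq_at_within)
    then have "\<forall>\<^sub>F z' in at z. (R z' g w - R z g w) / (z' - z) = R z' (R z g) w"
      by eventually_elim (simp add: resolvent_identity[OF z _ g])
    then show ?thesis
      unfolding has_field_derivative_iff
      by (subst tendsto_cong) (assumption, rule R_continuous[OF z R_l2(1)[OF z g]])
  qed
  then show ?thesis
    unfolding analytic_on_open[OF open_\<Omega>] holomorphic_on_open[OF open_\<Omega>] by blast
qed

section \<open>Walks and the Neumann series\<close>

text \<open>
  Walks are split at their last arc, since the end vertex is the argument on which \<open>A\<close> acts.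
\<close>

lemma walks_Suc:
  "{p. pre_digraph.awalk (with_proj G) v p w \<and> length p = Suc n}
    = (\<Union>u\<in>nbrs G w. (\<lambda>p. p @ [(u, w)]) ` {p. pre_digraph.awalk (with_proj G) v p u \<and> length p = n})"
    (is "?L = ?R")
proof -
  interpret pair_bidirected_digraph G by (rule bidirected)
  have snoc: "awalk v (p @ [e]) w \<longleftrightarrow> awalk v p (fst e) \<and> e \<in> parcs G \<and> w = snd e" for p e
    by (auto simp: awalk_simps)
  show ?thesis
  proof (intro set_eqI iffI)
    fix p assume "p \<in> ?L"
    then have p: "awalk v p w" "length p = Suc n"
      by auto
    then obtain p' u w' where "p = p' @ [(u, w')]"
      by (cases p rule: rev_cases) auto
    with p have "awalk v p' u" "(u, w) \<in> parcs G" "length p' = n" "p = p' @ [(u, w)]"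
      using snoc[of p' "(u, w')"] by simp_all
    then show "p \<in> ?R"
      using nbrs_sym[of w u] by (auto simp: nbrs_def)
  next
    fix p assume "p \<in> ?R"
    then obtain u p' where "u \<in> nbrs G w" "p = p' @ [(u, w)]" "awalk v p' u" "length p' = n"
      by blast
    then show "p \<in> ?L"
      using snoc[of p' "(u, w)"] nbrs_sym[of u w] by (simp add: nbrs_def)
  qed
qed

lemma finite_walks: "finite {p. pre_digraph.awalk (with_proj G) v p w \<and> length p = n}"
proof (induction n arbitrary: w)
  case 0
  show ?case by (rule finite_subset[of _ "{[]}"]) auto
next
  case (Suc n)
  then show ?case
    unfolding walks_Suc using finite_nbrs by blast
qed

lemma num_walks_Suc: "num_walks G v w (Suc n) = (\<Sum>u\<in>nbrs G w. num_walks G v u n)"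
  unfolding num_walks_def walks_Suc
  by (subst card_UN_disjoint) (auto simp: finite_nbrs finite_walks card_image inj_on_def)

lemma num_walks_0:
  assumes "v \<in> V"
  shows "num_walks G v w 0 = (if v = w then 1 else 0)"
proof -
  interpret pair_bidirected_digraph G by (rule bidirected)
  have "{p. awalk v p w \<and> length p = 0} = (if v = w then {[]} else {})"
    using assms by (auto simp: awalk_simps)
  then show ?thesis
    by (simp add: num_walks_def)
qed

text \<open>
  For \<open>b = - 1 / z\<close> the iteration reads \<open>f \<mapsto> (A f - g) / z\<close>, and with \<open>g = delta v\<close> its iterates
  are the partial sums of the walk series.
\<close>

lemma iter_step_walks:
  assumes v: "v \<in> V" and z: "z \<noteq> 0"
  shows "w \<in> V \<Longrightarrow> (iter_step z (- inverse z) (delta v) ^^ n) (\<lambda>u. 0) w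
      = - inverse z * (\<Sum>k<n. walk_term G z v w k)"
proof (induction n arbitrary: w)
  case (Suc n)
  define f where "f = (iter_step z (- inverse z) (delta v) ^^ n) (\<lambda>u. 0)"
  have "(iter_step z (- inverse z) (delta v) ^^ Suc n) (\<lambda>u. 0) w
      = inverse z * (A f w - delta v w)"
    using z by (simp add: f_def iter_step_def shift_op_def field_simps)
  also have "A f w = (\<Sum>u\<in>nbrs G w. - inverse z * (\<Sum>k<n. walk_term G z v u k))"
    using Suc nbrs_in_V by (auto simp: adj_op_def f_def intro!: sum.cong)
  also have "\<dots> = - (\<Sum>u\<in>nbrs G w. \<Sum>k<n. inverse z * walk_term G z v u k)"
    by (simp add: sum_distrib_left sum_negf)
  also have "\<dots> = - (\<Sum>k<n. \<Sum>u\<in>nbrs G w. inverse z * walk_term G z v u k)"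
    by (subst sum.swap) (rule refl)
  also have "\<dots> = - (\<Sum>k<n. walk_term G z v w (Suc k))"
    by (simp add: walk_term_def num_walks_Suc sum_distrib_left sum_distrib_right mult_ac)
  also have "delta v w = walk_term G z v w 0"
    using v by (auto simp: delta_def walk_term_def num_walks_0)
  also have "inverse z * (- (\<Sum>k<n. walk_term G z v w (Suc k)) - walk_term G z v w 0)
      = - inverse z * (\<Sum>k<Suc n. walk_term G z v w k)"
    by (simp only: sum.lessThan_Suc_shift) (simp add: algebra_simps)
  finally show ?case .
qed simp

lemma far_outside: "cmod z > real d \<Longrightarrow> z \<in> \<Omega>"
  by auto

lemma walk_series:
  assumes v: "v \<in> V" and w: "w \<in> V" and z: "cmod z > real d"
  shows "summable (walk_term G z v w)" and "R z (delta v) w = s_fun G z v w"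
proof -
  have z0: "z \<noteq> 0"
    using z by auto
  obtain f where f: "f \<in> l2 V" "T z f = delta v"
    and lim: "(\<lambda>n. (iter_step z (- inverse z) (delta v) ^^ n) (\<lambda>u. 0) w) \<longlonglongrightarrow> f w"
    using iteration_solves[OF contracts_far[OF z] delta_in_l2[OF v]] by blast
  have R: "R z (delta v) = f"
    by (rule R_unique[OF far_outside[OF z] f])
  have "(\<lambda>n. - z * (- inverse z * (\<Sum>k<n. walk_term G z v w k))) \<longlonglongrightarrow> - z * f w"
    using lim unfolding iter_step_walks[OF v z0 w] by (intro tendsto_intros)
  then have s: "walk_term G z v w sums (- z * f w)"
    unfolding sums_def using z0 by (simp add: mult.assoc[symmetric])
  then show "summable (walk_term G z v w)"
    by (rule sums_summable)
  show "R z (delta v) w = s_fun G z v w"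
    unfolding R s_fun_def sums_unique[OF s, symmetric] using z0 by simp
qed

lemma propagator_iff: "f \<in> l2 V \<Longrightarrow> propagator G z v f \<longleftrightarrow> T z f = delta v"
  by (simp add: propagator_def l2_def)

end

theorem mainTheorem8:
  fixes G :: "'a pair_pre_digraph" and d :: nat
  assumes "pair_bidirected_digraph G"
    and "Digraph_Component.connected (with_proj G)"
    and "degrees_le G d"
  shows
    "(- (complex_of_real ` {- real d..real d}) \<subseteq> resolvent_set (pverts G) (adj_op_l2 G) \<and>
      (\<forall>z\<in>- (complex_of_real ` {- real d..real d}).
         bounded_linear_on_l2 (pverts G) (resolvent G z)))
   \<and> (\<forall>v\<in>pverts G. \<forall>z\<in>- (complex_of_real ` {- real d..real d}).
        propagator G z v (resolvent G z (delta v)) \<and>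
        resolvent G z (delta v) \<in> l2 (pverts G) \<and>
        (\<forall>f. propagator G z v f \<and> f \<in> l2 (pverts G) \<longrightarrow> f = resolvent G z (delta v)))
   \<and> (\<forall>v\<in>pverts G. \<forall>w\<in>pverts G.
        (\<forall>z\<in>- (complex_of_real ` {- real d..real d}).
           s_tilde G z v w = l2_inner (pverts G) (resolvent G z (delta v)) (delta w)) \<and>
        (\<lambda>z. s_tilde G z v w) analytic_on - (complex_of_real ` {- real d..real d}) \<and>
        (\<forall>z. cmod z > real d \<longrightarrow>
           summable (walk_term G z v w) \<and> s_tilde G z v w = s_fun G z v w))"
proof -
  interpret bounded_degree_graph G d
    using assms(1,3) by (rule bounded_degree_graph.intro)
  note [simp] = delta_in_l2
  show ?thesis
  proof (intro conjI ballI allI impI subsetI)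
    fix z assume z: "z \<in> \<Omega>"
    show "z \<in> resolvent_set V (adj_op_l2 G)"
      using bij_adj_op_l2[OF z] by (simp add: resolvent_set_def)
    show "bounded_linear_on_l2 V (R z)"
      using z by (rule R_bounded_linear)
    fix v assume v: "v \<in> V"
    show l: "R z (delta v) \<in> l2 V"
      using z v by (simp add: R_l2)
    show "propagator G z v (R z (delta v))"
      using z v by (simp add: propagator_iff[OF l] R_l2)
    show "f = R z (delta v)" if "propagator G z v f \<and> f \<in> l2 V" for f
      using R_unique[OF z, of f] that propagator_iff by metis
  next
    fix v w z assume vw: "v \<in> V" "w \<in> V"
    show "s_tilde G z v w = l2_inner V (R z (delta v)) (delta w)"
      by (simp add: s_tilde_def l2_inner_delta[OF vw(2)])
    show "(\<lambda>z. s_tilde G z v w) analytic_on \<Omega>"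
      unfolding s_tilde_def using vw by (intro R_analytic) simp
    assume "cmod z > real d"
    then show "summable (walk_term G z v w)" "s_tilde G z v w = s_fun G z v w"
      using walk_series[OF vw] by (auto simp: s_tilde_def)
  qed
qed

end
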